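(* Let $k\in[0,1]$ and $\omega\in[-1,1]$ be real numbers, let $r,s$ be (large) positive integers, let $M\in[-1,1]$, and let $X=M\cdot R_{r\cdot s}(\omega,k)$, where $R_{r\cdot s}(\omega,k)=R_r(R_s(\omega,k),k)$. Given the public key $(\omega,k,R_s(\omega,k))$ and the ciphertext $(R_r(\omega,k),X)$, consider the following attack: compute an integer index $r'$ such that $R_{r'}(\omega,k)=R_r(\omega,k)$; evaluate $R_{r'\cdot s}(\omega,k)=R_{r'}(R_s(\omega,k),k)$; output $X/R_{r'\cdot s}(\omega,k)$. This attack is always successful, i.e. it recovers $M=\dfrac{X}{R_{r'\cdot s}(\omega,k)}$, because if $r'$ is such that $R_{r'}(\omega,k)=R_r(\omega,k)$, then $$R_{r\cdot s}(\omega,k)=R_{s\cdot r}(\omega,k)=R_s(R_r(\omega,k),k)=R_s(R_{r'}(\omega,k),k)=R_{s\cdot r'}(\omega,k)=R_{r'\cdot s}(\omega,k)=R_{r'}(R_s(\omega,k),k).$$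
   Context: For a real number $k\in[0,1]$ (the modulus) and a real number $\omega\in[-1,1]$, the Jacobian elliptic Chebyshev rational maps $R_p(\omega,k)$, $p=0,1,2,\dots$, are defined by $R_0(\omega,k)=1$, $R_1(\omega,k)=\omega$, and, for every positive integer $p$, $$R_{p+1}(\omega,k)=\frac{2\omega}{1-k^2(1-R_p(\omega,k)^2)(1-\omega^2)}\,R_p(\omega,k)-R_{p-1}(\omega,k).$$ In the public key cryptosystem considered, Alice generates a large integer $s$ (her private key), selects random $\omega\in[-1,1]$ and $k\in[0,1]$, and publishes the public key $(\omega,k,R_s(\omega,k))$. To encrypt a message represented as a number $M\in[-1,1]$, Bob generates a large integer $r$, computes $R_r(\omega,k)$, $R_{r\cdot s}(\omega,k)=R_r(R_s(\omega,k),k)$ and $X=M\cdot R_{r\cdot s}(\omega,k)$, and sends the ciphertext $(R_r(\omega,k),X)$.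
   Formalization: The recovery M = X/R_{r'·s}(ω,k) is claimed only when R_{r·s}(ω,k) ≠ 0, since otherwise X = 0 and the quotient is undefined (e.g. k = 0, ω = 0, r = s = 1); the chain of equalities is claimed without this condition. *)

theory Defs
  imports Complex_Main
begin

text \<open>
  For \<open>k \<in> [0,1]\<close> and \<open>\<omega> \<in> [-1,1]\<close> all values stay in \<open>[-1,1]\<close>, so the denominator
  vanishes only for \<open>k = 1\<close>, \<open>\<omega> = 0\<close> (at a zero of the preceding map). There the
  convention \<open>x / 0 = 0\<close> applies and the maps take the values \<open>1, 0, -1, 0, 1, \<dots>\<close>.
\<close>
fun ell_cheb :: "nat \<Rightarrow> real \<Rightarrow> real \<Rightarrow> real" where
  "ell_cheb 0 \<omega> k = 1"
| "ell_cheb (Suc 0) \<omega> k = \<omega>"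
| "ell_cheb (Suc (Suc p)) \<omega> k =
     2 * \<omega> / (1 - k\<^sup>2 * (1 - (ell_cheb (Suc p) \<omega> k)\<^sup>2) * (1 - \<omega>\<^sup>2)) * ell_cheb (Suc p) \<omega> k
       - ell_cheb p \<omega> k"

text \<open>
  The attack sees only a public key \<open>(\<omega>, k, S)\<close> and a ciphertext \<open>(C, X)\<close>; the secret
  \<open>r\<close>, \<open>s\<close> and \<open>M\<close> are not among its arguments.
\<close>
fun attack_index :: "real \<times> real \<times> real \<Rightarrow> real \<times> real \<Rightarrow> nat \<Rightarrow> bool" where
  "attack_index (\<omega>, k, S) (C, X) r' \<longleftrightarrow> ell_cheb r' \<omega> k = C"

fun attack_output :: "real \<times> real \<times> real \<Rightarrow> real \<times> real \<Rightarrow> nat \<Rightarrow> real" where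
  "attack_output (\<omega>, k, S) (C, X) r' = X / ell_cheb r' S k"

end

(* Idea: for 0 <= k < 1 write \<omega> = cn u. The recursion is the addition theorem
   cn(x+y) + cn(x-y) = 2 cn x cn y / (1 - k^2 sn^2 x sn^2 y) with x = p u and y = u, so
   R_p(cn u) = cn(p u), whence R_p(R_q(cn u)) = cn(p q u). The function cn is cos o am, where am
   inverts the elliptic integral of the first kind; its addition theorem holds because
   (cn x cn y + e sn x sn y dn x dn y) / (1 - k^2 sn^2 x sn^2 y) with y = a + e x is constant in x
   for e = 1, -1. For k = 1, sech is not onto [-1,1], so the functions n -> (sgn \<omega>)^n sech(n t)
   (if \<omega> is nonzero) and n -> cos(n pi/2) (if \<omega> = 0) take its place; hence the functional
   equation is required on the integers only. *)
theory Submission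
  imports Defs "HOL-Analysis.Interval_Integral"
begin

section \<open>Integer solutions of the functional equation\<close>

text \<open>At \<open>m = (p + 1) * n\<close> the equation is the recursion step. Both sides read
  division with \<open>x / 0 = 0\<close>, so the match persists where a denominator
  vanishes.\<close>

lemma ell_cheb_functional_equation:
  fixes f :: "int \<Rightarrow> real" and k :: real
  assumes f0: "f 0 = 1"
    and f: "\<And>m n. f (m + n) + f (m - n) = 2 * f m * f n / (1 - k\<^sup>2 * (1 - (f m)\<^sup>2) * (1 - (f n)\<^sup>2))"
  shows "ell_cheb p (f n) k = f (int p * n)"
proof (induction p rule: induct_nat_012)
  case 0
  show ?case by (simp add: f0)
next
  case 1
  show ?case by simp
next
  case (ge2 p)
  have "int (Suc p) * n + n = int (Suc (Suc p)) * n" "int (Suc p) * n - n = int p * n"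
    by (simp_all add: algebra_simps)
  with f[of "int (Suc p) * n" n] ge2 show ?case
    by (simp only: ell_cheb.simps) (simp add: mult_ac diff_eq_eq add_ac del: of_nat_Suc)
qed

text \<open>The inner value \<open>f q\<close> is again a value of \<open>f\<close>, so the
  iteration can restart from it and reaches \<open>f (p * q)\<close> either way.\<close>

lemma ell_cheb_comp_functional_equation:
  fixes f :: "int \<Rightarrow> real" and k :: real
  assumes "f 0 = 1"
    and "\<And>m n. f (m + n) + f (m - n) = 2 * f m * f n / (1 - k\<^sup>2 * (1 - (f m)\<^sup>2) * (1 - (f n)\<^sup>2))"
  shows "ell_cheb (p * q) (f 1) k = ell_cheb p (ell_cheb q (f 1) k) k"
proof -
  note iterate = ell_cheb_functional_equation[of f k, OF assms]
  show ?thesis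
    by (simp add: iterate)
qed

section \<open>Antiderivatives and inverse functions\<close>

text \<open>Provides the elliptic integral on the whole line, negative arguments included.\<close>

lemma exists_global_antiderivative:
  fixes g :: "real \<Rightarrow> real"
  assumes "continuous_on UNIV g"
  obtains F where "\<And>x. (F has_real_derivative g x) (at x)" "F 0 = 0"
proof -
  have "\<exists>F. \<forall>x. -\<infinity> < ereal x \<longrightarrow> ereal x < \<infinity> \<longrightarrow> (F has_vector_derivative g x) (at x)"
    using assms by (intro einterval_antiderivative) (auto simp: continuous_on_eq_continuous_at)
  then obtain F where F: "\<And>x. (F has_real_derivative g x) (at x)"
    by (auto simp: has_real_derivative_iff_has_vector_derivative)
  show ?thesis
  proof
    show "((\<lambda>x. F x - F 0) has_real_derivative g x) (at x)" for x
      by (auto intro!: derivative_eq_intros F)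
  qed simp
qed

text \<open>A slope of at least 1 makes \<open>F\<close> injective and unbounded in both directions,
  hence a bijection of the line. For the elliptic integral, \<open>G\<close> is the
  amplitude.\<close>

lemma exists_differentiable_inverse:
  fixes F g :: "real \<Rightarrow> real"
  assumes F: "\<And>x. (F has_real_derivative g x) (at x)" and g: "\<And>x. 1 \<le> g x"
  obtains G where "\<And>x. G (F x) = x" "\<And>y. (G has_real_derivative inverse (g (G y))) (at y)"
proof -
  have grow: "y - x \<le> F y - F x" if "x \<le> y" for x y
  proof -
    have "(\<lambda>x. F x - x) x \<le> (\<lambda>x. F x - x) y"
      using that by (rule DERIV_nonneg_imp_nondecreasing)
        (use F g in \<open>force intro!: derivative_eq_intros exI\<close>)
    then show ?thesis by simp
  qed
  have contF: "isCont F x" for x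
    using F DERIV_isCont by blast
  have inj: "inj F"
  proof (rule injI)
    fix x y assume "F x = F y"
    then show "x = y"
      using grow[of x y] grow[of y x] by linarith
  qed
  have "surj F"
  proof -
    have "\<exists>x. F x = y" for y
    proof -
      \<comment> \<open>By \<open>grow\<close>,
        \<open>F (-b) \<le> F 0 - b \<le> y \<le> F 0 + b \<le> F b\<close>.\<close>
      define b where "b = \<bar>y - F 0\<bar>"
      have "\<exists>x\<ge>-b. x \<le> b \<and> F x = y"
        using grow[of "-b" 0] grow[of 0 b] contF by (intro IVT) (auto simp: b_def)
      then show ?thesis by blast
    qed
    then show ?thesis by (metis surj_def)
  qed
  define G where "G = inv F"
  have GF: "G (F x) = x" and FG: "F (G x) = x" for x
    using inj \<open>surj F\<close> by (simp_all add: G_def surj_f_inv_f)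
  have contG: "isCont G y" for y
    using isCont_inverse_function[of 1 "G y" G F] contF by (simp add: GF FG)
  have "(G has_real_derivative inverse (g (G y))) (at y)" for y
    by (rule DERIV_inverse_function[where f = F and a = "y - 1" and b = "y + 1"])
      (use F g[of "G y"] contG FG in auto)
  with GF show ?thesis by (rule that)
qed

section \<open>The Jacobi function cn for k < 1\<close>

lemma cn_addition:
  fixes sn cn dn :: "real \<Rightarrow> real" and k e u v :: real
  assumes k: "0 \<le> k" "k < 1" and e: "e = 1 \<or> e = -1"
    and sn': "\<And>x. (sn has_real_derivative cn x * dn x) (at x)"
    and cn': "\<And>x. (cn has_real_derivative - sn x * dn x) (at x)"
    and dn': "\<And>x. (dn has_real_derivative - k\<^sup>2 * sn x * cn x) (at x)"
    and cn2: "\<And>x. (cn x)\<^sup>2 = 1 - (sn x)\<^sup>2" and dn2: "\<And>x. (dn x)\<^sup>2 = 1 - k\<^sup>2 * (sn x)\<^sup>2"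
    and at0: "sn 0 = 0" "cn 0 = 1"
  shows "cn (u - e * v) = (cn u * cn v + e * sn u * sn v * dn u * dn v) / (1 - k\<^sup>2 * (sn u)\<^sup>2 * (sn v)\<^sup>2)"
proof -
  have D: "1 - k\<^sup>2 * (sn x)\<^sup>2 * (sn y)\<^sup>2 > 0" for x y
  proof -
    have "(sn z)\<^sup>2 \<le> 1" for z
      using cn2[of z] zero_le_power2[of "cn z"] by linarith
    then have "(sn x)\<^sup>2 * (sn y)\<^sup>2 \<le> 1"
      by (simp add: mult_le_one)
    then have "k\<^sup>2 * ((sn x)\<^sup>2 * (sn y)\<^sup>2) \<le> k\<^sup>2"
      using mult_left_mono[of _ 1 "k\<^sup>2"] by fastforce
    also have "k\<^sup>2 < 1"
      using k by (simp add: power_less_one_iff)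
    finally show ?thesis by (simp add: mult.assoc)
  qed
  \<comment> \<open>With this shift, \<open>a + e * x\<close> is \<open>u\<close> at
    \<open>x = v\<close>, which gives the right-hand side, and \<open>a\<close> at
    \<open>x = 0\<close>, where the quotient reduces to \<open>cn a\<close>.\<close>
  define a where "a = u - e * v"
  define N where "N x = cn x * cn (a + e * x) + e * sn x * sn (a + e * x) * dn x * dn (a + e * x)" for x
  define Q where "Q x = 1 - k\<^sup>2 * (sn x)\<^sup>2 * (sn (a + e * x))\<^sup>2" for x
  have "((\<lambda>x. N x / Q x) has_real_derivative 0) (at x)" for x
  proof -
    define y where "y = a + e * x"
    have chain: "((\<lambda>x. f (a + e * x)) has_real_derivative f' y * e) (at x)"
      if "\<And>x. (f has_real_derivative f' x) (at x)" for f f'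
      unfolding y_def by (rule DERIV_chain2[OF that]) (auto intro!: derivative_eq_intros)
    note d = chain[OF sn'] chain[OF cn'] chain[OF dn'] sn' cn' dn'
    \<comment> \<open>\<open>W\<close> is a common factor of the derivatives of \<open>N\<close> and
      \<open>Q\<close>. Once it is split off, the quotient rule leaves a polynomial identity modulo
      \<open>e2\<close> and \<open>sq\<close>.\<close>
    define W where "W = - 2 * k\<^sup>2 * sn x * sn y"
    have e2: "e * e = 1" using e by auto
    have sq: "cn z * cn z = 1 - sn z * sn z" "dn z * dn z = 1 - k * k * (sn z * sn z)" for z
      using cn2[of z] dn2[of z] by (simp_all add: power2_eq_square)
    have N': "(N has_real_derivative W * (sn y * cn y * dn x + e * sn x * cn x * dn y)) (at x)"
      unfolding N_def
      apply (rule derivative_eq_intros d refl)+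
      apply (simp only: y_def[symmetric] W_def power2_eq_square)
      using e2 sq[of x] sq[of y] apply algebra
      done
    have Q': "(Q has_real_derivative W * (cn x * dn x * sn y + e * sn x * cn y * dn y)) (at x)"
      unfolding Q_def
      apply (rule derivative_eq_intros d refl)+
      apply (simp only: y_def[symmetric] W_def power2_eq_square)
      apply (simp add: algebra_simps)
      done
    have "(sn y * cn y * dn x + e * sn x * cn x * dn y) * Q x
        = N x * (cn x * dn x * sn y + e * sn x * cn y * dn y)"
      unfolding N_def Q_def y_def[symmetric] power2_eq_square
      using e2 sq[of x] sq[of y] by algebra
    then show ?thesis
      using DERIV_divide[OF N' Q'] D[of x y] by (simp add: Q_def y_def mult.assoc mult.left_commute)
  qed
  then have "N v / Q v = N 0 / Q 0"
    by (intro DERIV_isconst_all) blast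
  then show "cn (u - e * v) = (cn u * cn v + e * sn u * sn v * dn u * dn v) / (1 - k\<^sup>2 * (sn u)\<^sup>2 * (sn v)\<^sup>2)"
    by (simp add: N_def Q_def at0 a_def mult.commute mult.left_commute)
qed

text \<open>Since \<open>k < 1\<close>, the integrand \<open>inverse (\<Delta> t)\<close> is
  continuous and at least 1, so the elliptic integral \<open>F\<close> has a global inverse
  \<open>am\<close>. Its equation \<open>am' = \<Delta> (am y)\<close> yields the differential
  equations of \<open>sn\<close>, \<open>cn\<close>, \<open>dn\<close>.\<close>

lemma exists_jacobi_cn:
  fixes k \<omega> :: real
  assumes k: "0 \<le> k" "k < 1" and \<omega>: "-1 \<le> \<omega>" "\<omega> \<le> 1"
  obtains cn :: "real \<Rightarrow> real" and u where "cn 0 = 1" "cn u = \<omega>"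
    "\<And>x y. cn (x + y) + cn (x - y) = 2 * cn x * cn y / (1 - k\<^sup>2 * (1 - (cn x)\<^sup>2) * (1 - (cn y)\<^sup>2))"
proof -
  define \<Delta> where "\<Delta> t = sqrt (1 - k\<^sup>2 * (sin t)\<^sup>2)" for t
  have rad: "0 < 1 - k\<^sup>2 * (sin t)\<^sup>2" for t
  proof -
    have "k\<^sup>2 * (sin t)\<^sup>2 \<le> k\<^sup>2"
      by (simp add: mult_left_le abs_square_le_1)
    also have "k\<^sup>2 < 1"
      using k by (simp add: power_less_one_iff)
    finally show ?thesis by simp
  qed
  have \<Delta>pos: "0 < \<Delta> t" and \<Delta>sq: "(\<Delta> t)\<^sup>2 = 1 - k\<^sup>2 * (sin t)\<^sup>2" for t
    using rad[of t] by (simp_all add: \<Delta>_def)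
  have \<Delta>le: "\<Delta> t \<le> 1" for t
    by (simp add: \<Delta>_def)
  have "continuous_on UNIV (\<lambda>t. inverse (\<Delta> t))"
    using \<Delta>pos by (auto intro!: continuous_intros simp: \<Delta>_def less_imp_neq[symmetric])
  then obtain F where F: "\<And>x. (F has_real_derivative inverse (\<Delta> x)) (at x)" and F0: "F 0 = 0"
    by (rule exists_global_antiderivative) blast
  obtain am where amF: "\<And>x. am (F x) = x"
    and am': "\<And>y. (am has_real_derivative inverse (inverse (\<Delta> (am y)))) (at y)"
    using exists_differentiable_inverse[OF F] \<Delta>pos \<Delta>le by (metis one_le_inverse)
  have am': "(am has_real_derivative \<Delta> (am y)) (at y)" for y
    using am'[of y] by simp
  define sn cn dn where "sn y = sin (am y)" and "cn y = cos (am y)" and "dn y = \<Delta> (am y)" for y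
  have am0: "am 0 = 0"
    using amF[of 0] F0 by simp
  have sn': "(sn has_real_derivative cn x * dn x) (at x)" for x
    unfolding sn_def cn_def dn_def by (auto intro!: derivative_eq_intros am')
  have cn': "(cn has_real_derivative - sn x * dn x) (at x)" for x
    unfolding sn_def cn_def dn_def by (auto intro!: derivative_eq_intros am')
  have \<Delta>': "(\<Delta> has_real_derivative - k\<^sup>2 * sin t * cos t / \<Delta> t) (at t)" for t
    unfolding \<Delta>_def using rad[of t]
    by (auto intro!: derivative_eq_intros simp: field_simps)
  have dn': "(dn has_real_derivative - k\<^sup>2 * sn x * cn x) (at x)" for x
    using DERIV_chain2[OF \<Delta>' am', of x] \<Delta>pos[of "am x"]
    unfolding sn_def cn_def dn_def by simp
  have cn2: "(cn x)\<^sup>2 = 1 - (sn x)\<^sup>2" for x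
    by (simp add: sn_def cn_def cos_squared_eq)
  have dn2: "(dn x)\<^sup>2 = 1 - k\<^sup>2 * (sn x)\<^sup>2" for x
    by (simp add: dn_def sn_def \<Delta>sq)
  have at0: "sn 0 = 0" "cn 0 = 1"
    by (simp_all add: sn_def cn_def am0)
  note add = cn_addition[OF k _ sn' cn' dn' cn2 dn2 at0]
  show ?thesis
  proof (rule that[of cn "F (arccos \<omega>)"])
    show "cn 0 = 1" by (fact at0)
    show "cn (F (arccos \<omega>)) = \<omega>"
      using \<omega> by (simp add: cn_def amF)
    show "cn (x + y) + cn (x - y) = 2 * cn x * cn y / (1 - k\<^sup>2 * (1 - (cn x)\<^sup>2) * (1 - (cn y)\<^sup>2))" for x y
      \<comment> \<open>The two signs give \<open>cn (x + y)\<close> and \<open>cn (x - y)\<close>;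
        the terms with \<open>sn\<close> and \<open>dn\<close> in the numerators cancel in the
        sum.\<close>
      using add[of "-1" x y] add[of 1 x y]
      by (simp add: cn2 add_divide_distrib[symmetric] diff_divide_distrib[symmetric])
  qed
qed

section \<open>The modulus k = 1\<close>

text \<open>The function sech is cn at modulus 1. The product
  \<open>cosh (x + y) * cosh (x - y)\<close> is also the numerator of the right-hand denominator
  once its fractions are cleared.\<close>

lemma sech_addition:
  fixes x y :: real
  shows "1 / cosh (x + y) + 1 / cosh (x - y)
    = 2 * (1 / cosh x) * (1 / cosh y) / (1 - (1 - (1 / cosh x)\<^sup>2) * (1 - (1 / cosh y)\<^sup>2))"
proof -
  have pos: "0 < cosh x" "0 < cosh y" "0 < cosh (x + y)" "0 < cosh (x - y)"
    by simp_all
  have prod: "cosh (x + y) * cosh (x - y) = (cosh x)\<^sup>2 + (cosh y)\<^sup>2 - 1"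
    unfolding cosh_add cosh_diff
    using cosh_square_eq[of x] cosh_square_eq[of y] by algebra
  have sum: "cosh (x + y) + cosh (x - y) = 2 * cosh x * cosh y"
    by (simp add: cosh_add cosh_diff)
  have "1 / cosh (x + y) + 1 / cosh (x - y) = 2 * cosh x * cosh y / ((cosh x)\<^sup>2 + (cosh y)\<^sup>2 - 1)"
    unfolding prod[symmetric] sum[symmetric] using pos by (simp add: field_simps)
  moreover have "1 - (1 - (1 / cosh x)\<^sup>2) * (1 - (1 / cosh y)\<^sup>2)
      = ((cosh x)\<^sup>2 + (cosh y)\<^sup>2 - 1) / ((cosh x)\<^sup>2 * (cosh y)\<^sup>2)"
    using pos by (simp add: field_simps)
  ultimately show ?thesis
    by (simp add: power2_eq_square)
qed

lemma ell_cheb_comp_1: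
  fixes \<omega> :: real
  assumes "-1 \<le> \<omega>" "\<omega> \<le> 1"
  shows "ell_cheb (p * q) \<omega> 1 = ell_cheb p (ell_cheb q \<omega> 1) 1"
proof (cases "\<omega> = 0")
  case True
  \<comment> \<open>If \<open>m\<close>, \<open>n\<close> are odd, the denominator vanishes, but then so does the left-hand side.\<close>
  define f where "f n = cos (of_int n * (pi / 2))" for n :: int
  have f_even: "(f n)\<^sup>2 = 1" if "even n" for n
  proof -
    from \<open>even n\<close> obtain m where "n = 2 * m" by (rule evenE)
    then have "f n = cos (pi * of_int m)" by (simp add: f_def mult.commute)
    then show ?thesis
      by (simp add: cos_npi_int)
  qed
  have f_odd: "f n = 0" if "odd n" for n
  proof -
    from \<open>odd n\<close> obtain m where "n = 2 * m + 1" by (rule oddE)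
    then have "f n = cos (pi * of_int m + pi / 2)" by (simp add: f_def field_simps)
    then show ?thesis
      by (simp add: cos_add sin_npi_int)
  qed
  have f: "f (m + n) + f (m - n) = 2 * f m * f n / (1 - 1\<^sup>2 * (1 - (f m)\<^sup>2) * (1 - (f n)\<^sup>2))" for m n
  proof -
    have "f (m + n) + f (m - n) = 2 * f m * f n"
      unfolding f_def of_int_add of_int_diff distrib_right left_diff_distrib cos_add cos_diff
      by simp
    then show ?thesis
      by (cases "even m") (auto simp: f_even f_odd)
  qed
  have "f 0 = 1" "f 1 = 0"
    by (simp_all add: f_def)
  with ell_cheb_comp_functional_equation[of f 1 p q] f True show ?thesis
    by simp
next
  case False
  define e where "e = sgn \<omega>"
  \<comment> \<open>This puts \<open>1 / \<bar>\<omega>\<bar>\<close> in the range of cosh, so some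
    \<open>t\<close> has sech value \<open>\<bar>\<omega>\<bar>\<close>.\<close>
  have "1 \<le> 1 / \<bar>\<omega>\<bar>"
    using assms False by (simp add: field_simps abs_le_iff)
  then have cosh_t: "cosh (arcosh (1 / \<bar>\<omega>\<bar>)) = 1 / \<bar>\<omega>\<bar>"
    by (simp add: cosh_arcosh_real)
  define t where "t = arcosh (1 / \<bar>\<omega>\<bar>)"
  \<comment> \<open>As sech is positive, the sign of \<open>\<omega>\<close> is carried by a
    character of the integers. It factors out of both sides of the equation and disappears from the
    squares.\<close>
  define \<sigma> where "\<sigma> n = (if even n then 1 else e)" for n :: int
  have e2: "e * e = 1"
    using False by (simp add: e_def sgn_if)
  have \<sigma>2: "(\<sigma> n)\<^sup>2 = 1" for n
    by (simp add: \<sigma>_def e2 power2_eq_square)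
  have \<sigma>_add: "\<sigma> (m + n) = \<sigma> m * \<sigma> n" "\<sigma> (m - n) = \<sigma> m * \<sigma> n" for m n
    by (auto simp: \<sigma>_def e2)
  define f where "f n = \<sigma> n * (1 / cosh (of_int n * t))" for n :: int
  have fsq: "(f n)\<^sup>2 = (1 / cosh (of_int n * t))\<^sup>2" for n
    unfolding f_def power_mult_distrib \<sigma>2 by simp
  have f: "f (m + n) + f (m - n) = 2 * f m * f n / (1 - 1\<^sup>2 * (1 - (f m)\<^sup>2) * (1 - (f n)\<^sup>2))" for m n
  proof -
    have "f (m + n) + f (m - n)
        = \<sigma> m * \<sigma> n * (1 / cosh (of_int m * t + of_int n * t) + 1 / cosh (of_int m * t - of_int n * t))"
      by (simp add: f_def \<sigma>_add ring_distribs left_diff_distrib add_divide_distrib)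
    then show ?thesis
      unfolding sech_addition fsq by (simp add: f_def mult_ac)
  qed
  have "f 0 = 1" "f 1 = \<omega>"
    using cosh_t by (simp_all add: f_def \<sigma>_def e_def t_def sgn_mult_abs)
  with ell_cheb_comp_functional_equation[of f 1 p q] f show ?thesis
    by simp
qed

section \<open>The composition law and the attack\<close>

text \<open>For \<open>k < 1\<close>, sampling \<open>cn\<close> at the integer multiples of
  \<open>u\<close> gives a solution of the functional equation with value \<open>\<omega>\<close> at
  1.\<close>

theorem ell_cheb_comp:
  fixes k \<omega> :: real
  assumes "0 \<le> k" "k \<le> 1" "-1 \<le> \<omega>" "\<omega> \<le> 1"
  shows "ell_cheb (p * q) \<omega> k = ell_cheb p (ell_cheb q \<omega> k) k"
proof (cases "k = 1")
  case True
  with assms show ?thesis by (simp add: ell_cheb_comp_1)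
next
  case False
  with assms have "k < 1" by simp
  then obtain cn :: "real \<Rightarrow> real" and u where cn: "cn 0 = 1" "cn u = \<omega>"
    "\<And>x y. cn (x + y) + cn (x - y) = 2 * cn x * cn y / (1 - k\<^sup>2 * (1 - (cn x)\<^sup>2) * (1 - (cn y)\<^sup>2))"
    using exists_jacobi_cn[of k \<omega>] assms by metis
  show ?thesis
    using ell_cheb_comp_functional_equation[of "\<lambda>n. cn (of_int n * u)" k p q] cn
    by (simp add: ring_distribs left_diff_distrib)
qed

text \<open>Commuting the indices makes \<open>ell_cheb s\<close> the outer map, whose argument is
  the same for \<open>r\<close> and \<open>r'\<close>. Recovery is claimed for a nonzero mask only:
  a zero mask gives \<open>X = 0\<close> for every \<open>M\<close>.\<close>

theorem mainTheorem3:
  fixes k \<omega> M X :: real and r s r' :: nat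
  assumes "0 \<le> k" and "k \<le> 1"
    and "-1 \<le> \<omega>" and "\<omega> \<le> 1"
    and "0 < r" and "0 < s"
    and "-1 \<le> M" and "M \<le> 1"
    and "X = M * ell_cheb (r * s) \<omega> k"
    and "attack_index (\<omega>, k, ell_cheb s \<omega> k) (ell_cheb r \<omega> k, X) r'"
  shows "ell_cheb (r * s) \<omega> k = ell_cheb r (ell_cheb s \<omega> k) k
    \<and> ell_cheb (r * s) \<omega> k = ell_cheb (s * r) \<omega> k
    \<and> ell_cheb (s * r) \<omega> k = ell_cheb s (ell_cheb r \<omega> k) k
    \<and> ell_cheb s (ell_cheb r \<omega> k) k = ell_cheb s (ell_cheb r' \<omega> k) k
    \<and> ell_cheb s (ell_cheb r' \<omega> k) k = ell_cheb (s * r') \<omega> k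
    \<and> ell_cheb (s * r') \<omega> k = ell_cheb (r' * s) \<omega> k
    \<and> ell_cheb (r' * s) \<omega> k = ell_cheb r' (ell_cheb s \<omega> k) k
    \<and> (ell_cheb (r * s) \<omega> k \<noteq> 0 \<longrightarrow>
         M = X / ell_cheb (r' * s) \<omega> k
         \<and> attack_output (\<omega>, k, ell_cheb s \<omega> k) (ell_cheb r \<omega> k, X) r' = M)"
proof -
  note comp = ell_cheb_comp[OF assms(1-4)]
  have attack: "ell_cheb r' \<omega> k = ell_cheb r \<omega> k"
    using assms(10) by simp
  have "ell_cheb (r' * s) \<omega> k = ell_cheb (r * s) \<omega> k"
    using comp[of s r] comp[of s r'] attack by (simp add: mult.commute)
  then show ?thesis
    using assms(9) attack comp[of r s] comp[of s r] comp[of s r'] comp[of r' s]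
    by (simp add: mult.commute)
qed

end
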